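(* Let $\alpha,\beta\in\mathbb R$ with $\beta\ge0$ and $-\alpha<\beta$. Let $\mathbf h_{\alpha\beta}$ be the left-invariant metric on the horizontal sub-bundle $\mathcal H$ of $T\,\mathrm{Diff}\,S^1$ obtained by left translation of the inner product $(x,y)_{\alpha\beta}=\omega_{\alpha\beta}(Jx,y)$ on $\mathrm{Vect}_0S^1$. If $\gamma\colon I\to\mathrm{Diff}\,S^1$ is a normal sub-Riemannian geodesic for $\mathbf h_{\alpha\beta}$, then its left logarithmic derivative $u=\kappa^\ell(\dot\gamma)$ satisfies, for some constant $\lambda\in\mathbb R$, $$L_{\alpha\beta}J\dot u'=u\,L_{\alpha\beta}Ju''+2u'\,L_{\alpha\beta}Ju'-2\lambda u'.$$
   Context: $I=[0,1]$; $'=\partial_\theta$, $\dot{}=\partial_t$; curves are smooth. $\mathrm{Diff}\,S^1$ is the Fréchet Lie group of orientation preserving diffeomorphisms of $S^1=\mathbb R/2\pi\mathbb Z$, with Lie algebra $\mathrm{Vect}\,S^1\cong C^\infty(S^1)$ (identify $x\,\partial_\theta$ with $x$), bracket $[x,y]=x'y-y'x$. The left logarithmic derivative of $\gamma$ is $\kappa^\ell(\dot\gamma)=\dot\gamma/\gamma'$. $\eta(x)=\frac1{2\pi}\int_0^{2\pi}x\,d\theta$, $\mathrm{Vect}_0S^1=\ker\eta$, and $\mathfrak k$ is the space of constant vector fields, so $\mathrm{Vect}\,S^1=\mathrm{Vect}_0S^1\oplus\mathfrak k$. $\mathcal H$ is the sub-bundle obtained by left translations of $\mathrm{Vect}_0S^1$.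 $L_{\alpha\beta}x=\beta x''-\alpha x$; $$\omega_{\alpha\beta}(x,y)=\frac1{2\pi}\int_0^{2\pi}(\alpha xy'+\beta x'y'')\,d\theta,\qquad Jx(\theta)=\frac1{2\pi}\,\mathrm{p.v.}\int_0^{2\pi}\frac{x(t)}{\tan\left(\frac{t-\theta}2\right)}\,dt .$$ The inner product is extended to $\mathrm{Vect}\,S^1$ by $(x,y)_{\alpha\beta}:=(x-\eta(x),y-\eta(y))_{\alpha\beta}+\eta(x)\eta(y)$; $\mathrm{ad}_x^\top$ denotes the adjoint of $\mathrm{ad}_x\colon y\mapsto[x,y]$ with respect to this extension. A normal sub-Riemannian geodesic is a horizontal critical curve of the energy $\frac12\int_0^1\mathbf h_{\alpha\beta}(\dot\gamma,\dot\gamma)dt$ with respect to horizontal variations fixing the endpoints, such that $u=\kappa^\ell(\dot\gamma)\in\mathrm{Vect}_0S^1$ satisfies $\dot u=\mathrm{pr}_{\mathrm{Vect}_0S^1}\mathrm{ad}_u^\top(u+\lambda)$, $\dot\lambda=\mathrm{pr}_{\mathfrak k}\mathrm{ad}_u^\top(u+\lambda)$ for some smooth curve $\lambda\colon I\to\mathfrak k$. *)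

theory Defs
  imports "HOL-Analysis.Analysis"
begin

section \<open>Smooth maps\<close>

text \<open>
  Derivatives are taken within \<open>S\<close>, hence are one-sided at boundary points such as the
  endpoints of \<open>{0..1}\<close>. The notion is only used for convex \<open>S\<close> with nonempty interior,
  where these derivatives are unique.
\<close>

primrec Ck_on :: "nat \<Rightarrow> ('a::euclidean_space \<Rightarrow> 'b::euclidean_space) \<Rightarrow> 'a set \<Rightarrow> bool" where
  "Ck_on 0 f S \<longleftrightarrow> continuous_on S f"
| "Ck_on (Suc k) f S \<longleftrightarrow>
     (\<exists>f'. (\<forall>x\<in>S. (f has_derivative f' x) (at x within S)) \<and> (\<forall>v. Ck_on k (\<lambda>x. f' x v) S))"

definition smooth_on :: "'a::euclidean_space set \<Rightarrow> ('a \<Rightarrow> 'b::euclidean_space) \<Rightarrow> bool" where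
  "smooth_on S f \<longleftrightarrow> (\<forall>k. Ck_on k f S)"


section \<open>Vector fields on the circle\<close>

text \<open>
  A vector field \<open>x \<partial>\<^sub>\<theta>\<close> on the circle is identified with the
  \<open>2\<pi>\<close>-periodic function \<open>x\<close> of the angle.
\<close>

definition Vect :: "(real \<Rightarrow> real) set" where
  "Vect = {x. smooth_on UNIV x \<and> (\<forall>\<theta>. x (\<theta> + 2 * pi) = x \<theta>)}"

definition eta :: "(real \<Rightarrow> real) \<Rightarrow> real" where
  "eta x = 1 / (2 * pi) * integral {0..2 * pi} x"

definition Vect0 :: "(real \<Rightarrow> real) set" where
  "Vect0 = {x \<in> Vect. eta x = 0}"

text \<open>
  Projections onto the summands of \<open>Vect = Vect0 \<oplus> \<kk>\<close>; the space \<open>\<kk>\<close> of constant fields is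
  identified with the reals.
\<close>

definition pr0 :: "(real \<Rightarrow> real) \<Rightarrow> real \<Rightarrow> real" where
  "pr0 x = (\<lambda>\<theta>. x \<theta> - eta x)"

abbreviation prk :: "(real \<Rightarrow> real) \<Rightarrow> real" where
  "prk \<equiv> eta"

definition ad :: "(real \<Rightarrow> real) \<Rightarrow> (real \<Rightarrow> real) \<Rightarrow> real \<Rightarrow> real" where
  "ad x y = (\<lambda>\<theta>. deriv x \<theta> * y \<theta> - deriv y \<theta> * x \<theta>)"

definition L :: "real \<Rightarrow> real \<Rightarrow> (real \<Rightarrow> real) \<Rightarrow> real \<Rightarrow> real" where
  "L \<alpha> \<beta> x = (\<lambda>\<theta>. \<beta> * deriv (deriv x) \<theta> - \<alpha> * x \<theta>)"

definition omega :: "real \<Rightarrow> real \<Rightarrow> (real \<Rightarrow> real) \<Rightarrow> (real \<Rightarrow> real) \<Rightarrow> real" where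
  "omega \<alpha> \<beta> x y = 1 / (2 * pi) *
     integral {0..2 * pi} (\<lambda>\<theta>. \<alpha> * x \<theta> * deriv y \<theta> + \<beta> * deriv x \<theta> * deriv (deriv y) \<theta>)"

text \<open>
  The principal value is the limit, as \<open>\<epsilon>\<close> decreases to \<open>0\<close>, of the integral over the points at
  circle distance at least \<open>\<epsilon>\<close> from \<open>\<theta>\<close>, that is, at distance at least \<open>\<epsilon>\<close> from every singularity
  \<open>\<theta> + 2\<pi>k\<close> of the kernel.
\<close>

definition J :: "(real \<Rightarrow> real) \<Rightarrow> real \<Rightarrow> real" where
  "J x = (\<lambda>\<theta>. 1 / (2 * pi) *
     Lim (at_right 0) (\<lambda>\<epsilon>. integral {t \<in> {0..2 * pi}. \<forall>k::int. \<epsilon> \<le> \<bar>t - \<theta> - 2 * pi * of_int k\<bar>}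
       (\<lambda>t. x t / tan ((t - \<theta>) / 2))))"

definition ip0 :: "real \<Rightarrow> real \<Rightarrow> (real \<Rightarrow> real) \<Rightarrow> (real \<Rightarrow> real) \<Rightarrow> real" where
  "ip0 \<alpha> \<beta> x y = omega \<alpha> \<beta> (J x) y"

definition ip :: "real \<Rightarrow> real \<Rightarrow> (real \<Rightarrow> real) \<Rightarrow> (real \<Rightarrow> real) \<Rightarrow> real" where
  "ip \<alpha> \<beta> x y = ip0 \<alpha> \<beta> (\<lambda>\<theta>. x \<theta> - eta x) (\<lambda>\<theta>. y \<theta> - eta y) + eta x * eta y"

text \<open>
  The constant \<^const>\<open>adjoint\<close> refers to the inner product of the class \<^class>\<open>real_inner\<close>, so it
  does not apply to a bilinear form \<open>B\<close> on a set \<open>V\<close> of functions.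
\<close>

definition is_adjoint_on ::
    "'v set \<Rightarrow> ('v \<Rightarrow> 'v \<Rightarrow> real) \<Rightarrow> ('v \<Rightarrow> 'v) \<Rightarrow> ('v \<Rightarrow> 'v) \<Rightarrow> bool" where
  "is_adjoint_on V B T A \<longleftrightarrow> (\<forall>z\<in>V. A z \<in> V) \<and> (\<forall>y\<in>V. \<forall>z\<in>V. B (T y) z = B y (A z))"


section \<open>Diffeomorphisms of the circle\<close>

text \<open>
  The circle is the unit circle in the complex plane, with angular coordinate
  \<open>\<theta> \<mapsto> cis \<theta>\<close>. Values of a diffeomorphism off the circle are irrelevant.
\<close>

definition dtheta :: "(complex \<Rightarrow> complex) \<Rightarrow> real \<Rightarrow> complex" where
  "dtheta g \<theta> = vector_derivative (\<lambda>\<theta>. g (cis \<theta>)) (at \<theta>)"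

text \<open>
  If \<open>g (cis \<theta>) = cis (\<phi> \<theta>)\<close> with \<open>\<phi>\<close> smooth, then \<open>dtheta g \<theta> / (\<i> * g (cis \<theta>))\<close> is the
  derivative of \<open>\<phi>\<close>; its positivity means that \<open>g\<close> preserves the orientation and that its inverse
  is smooth.
\<close>

definition DiffS1 :: "(complex \<Rightarrow> complex) set" where
  "DiffS1 = {g. bij_betw g (sphere 0 1) (sphere 0 1) \<and> smooth_on UNIV (\<lambda>\<theta>. g (cis \<theta>)) \<and>
     (\<forall>\<theta>. Re (dtheta g \<theta> / (\<i> * g (cis \<theta>))) > 0)}"

text \<open>
  Smoothness of a curve in the Frechet Lie group is joint smoothness in time and angle.
\<close>

definition smooth_curve :: "(real \<Rightarrow> complex \<Rightarrow> complex) \<Rightarrow> bool" where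
  "smooth_curve \<gamma> \<longleftrightarrow> (\<forall>t\<in>{0..1}. \<gamma> t \<in> DiffS1) \<and>
     smooth_on ({0..1} \<times> UNIV) (\<lambda>(t, \<theta>). \<gamma> t (cis \<theta>))"

definition dtime :: "(real \<Rightarrow> 'a::real_normed_vector) \<Rightarrow> real \<Rightarrow> 'a" where
  "dtime f t = vector_derivative f (at t within {0..1})"

text \<open>
  Tangent vectors at \<open>g\<close> are vector fields along \<open>g\<close>, written as functions of the angle of the
  base point.
\<close>

definition velocity :: "(real \<Rightarrow> complex \<Rightarrow> complex) \<Rightarrow> real \<Rightarrow> real \<Rightarrow> complex" where
  "velocity \<gamma> t = (\<lambda>\<theta>. dtime (\<lambda>s. \<gamma> s (cis \<theta>)) t)"

text \<open>
  Left translation by \<open>g\<close> maps \<open>x\<close> to \<open>x g'\<close>, and \<open>kappa g\<close> is its inverse on the tangent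
  space at \<open>g\<close>, where the quotient is real. With \<open>g (cis \<theta>) = cis (\<phi> \<theta>)\<close> for a curve of such
  \<open>g\<close>, the common factor \<open>\<i> * cis (\<phi> \<theta>)\<close> cancels and \<open>logderiv\<close> is the time derivative of
  \<open>\<phi>\<close> divided by its angular derivative.
\<close>

definition left_translate :: "(complex \<Rightarrow> complex) \<Rightarrow> (real \<Rightarrow> real) \<Rightarrow> real \<Rightarrow> complex" where
  "left_translate g x = (\<lambda>\<theta>. of_real (x \<theta>) * dtheta g \<theta>)"

definition kappa :: "(complex \<Rightarrow> complex) \<Rightarrow> (real \<Rightarrow> complex) \<Rightarrow> real \<Rightarrow> real" where
  "kappa g v = (\<lambda>\<theta>. Re (v \<theta> / dtheta g \<theta>))"

definition logderiv :: "(real \<Rightarrow> complex \<Rightarrow> complex) \<Rightarrow> real \<Rightarrow> real \<Rightarrow> real" where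
  "logderiv \<gamma> t = kappa (\<gamma> t) (velocity \<gamma> t)"

definition H :: "(complex \<Rightarrow> complex) \<Rightarrow> (real \<Rightarrow> complex) set" where
  "H g = left_translate g ` Vect0"

definition h :: "real \<Rightarrow> real \<Rightarrow> (complex \<Rightarrow> complex) \<Rightarrow> (real \<Rightarrow> complex) \<Rightarrow> (real \<Rightarrow> complex) \<Rightarrow> real" where
  "h \<alpha> \<beta> g v w = ip0 \<alpha> \<beta> (kappa g v) (kappa g w)"


section \<open>Normal sub-Riemannian geodesics\<close>

definition horizontal :: "(real \<Rightarrow> complex \<Rightarrow> complex) \<Rightarrow> bool" where
  "horizontal \<gamma> \<longleftrightarrow> smooth_curve \<gamma> \<and> (\<forall>t\<in>{0..1}. velocity \<gamma> t \<in> H (\<gamma> t))"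

definition energy :: "real \<Rightarrow> real \<Rightarrow> (real \<Rightarrow> complex \<Rightarrow> complex) \<Rightarrow> real" where
  "energy \<alpha> \<beta> \<gamma> = 1 / 2 * integral {0..1} (\<lambda>t. h \<alpha> \<beta> (\<gamma> t) (velocity \<gamma> t) (velocity \<gamma> t))"

definition horizontal_variation ::
    "(real \<Rightarrow> complex \<Rightarrow> complex) \<Rightarrow> real \<Rightarrow> (real \<Rightarrow> real \<Rightarrow> complex \<Rightarrow> complex) \<Rightarrow> bool" where
  "horizontal_variation \<gamma> \<delta> \<Gamma> \<longleftrightarrow>
     smooth_on ({-\<delta><..<\<delta>} \<times> {0..1} \<times> UNIV) (\<lambda>(s, t, \<theta>). \<Gamma> s t (cis \<theta>)) \<and>
     (\<forall>s\<in>{-\<delta><..<\<delta>}. horizontal (\<Gamma> s)) \<and>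
     (\<forall>t\<in>{0..1}. \<forall>z\<in>sphere 0 1. \<Gamma> 0 t z = \<gamma> t z) \<and>
     (\<forall>s\<in>{-\<delta><..<\<delta>}. \<forall>z\<in>sphere 0 1. \<Gamma> s 0 z = \<gamma> 0 z \<and> \<Gamma> s 1 z = \<gamma> 1 z)"

definition critical_horizontal :: "real \<Rightarrow> real \<Rightarrow> (real \<Rightarrow> complex \<Rightarrow> complex) \<Rightarrow> bool" where
  "critical_horizontal \<alpha> \<beta> \<gamma> \<longleftrightarrow> horizontal \<gamma> \<and>
     (\<forall>\<delta>>0. \<forall>\<Gamma>. horizontal_variation \<gamma> \<delta> \<Gamma> \<longrightarrow>
        ((\<lambda>s. energy \<alpha> \<beta> (\<Gamma> s)) has_real_derivative 0) (at 0))"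

text \<open>
  In the theorem's parameter range \<open>ip \<alpha> \<beta>\<close> is positive definite on \<^const>\<open>Vect\<close>, so the adjoint
  \<open>A t\<close> of \<open>ad (u t)\<close> is unique on \<^const>\<open>Vect\<close>.
\<close>

definition normal_geodesic :: "real \<Rightarrow> real \<Rightarrow> (real \<Rightarrow> complex \<Rightarrow> complex) \<Rightarrow> bool" where
  "normal_geodesic \<alpha> \<beta> \<gamma> \<longleftrightarrow> critical_horizontal \<alpha> \<beta> \<gamma> \<and>
     (let u = logderiv \<gamma> in
      (\<forall>t\<in>{0..1}. u t \<in> Vect0) \<and>
      (\<exists>A l. smooth_on {0..1} l \<and>
         (\<forall>t\<in>{0..1}. is_adjoint_on Vect (ip \<alpha> \<beta>) (ad (u t)) (A t) \<and>
            (\<forall>\<theta>. dtime (\<lambda>s. u s \<theta>) t = pr0 (A t (\<lambda>\<theta>. u t \<theta> + l t)) \<theta>) \<and>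
            dtime l t = prk (A t (\<lambda>\<theta>. u t \<theta> + l t)))))"

end

theory Submission
  imports Defs
begin

text \<open>
  For smooth periodic \<open>x\<close>, symmetrizing the principal value around the singularity gives
  \<open>J x \<theta> = 1/(2\<pi>) \<integral>\<^bsub>0\<^esub>\<^bsup>\<pi>\<^esup> (x (\<theta> + s) - x (\<theta> - s)) cot (s/2) ds\<close>, an integral with a jointly continuous
  integrand. Hence \<open>J\<close> commutes with \<open>\<partial>\<^sub>\<theta>\<close>, preserves smooth fields and is skew for the
  \<open>L\<^sup>2\<close> pairing, so that \<open>(x, z) = \<langle>x, L J z' + \<eta>(z)\<rangle>\<close>. For \<open>z = u + \<lambda>\<close>, testing the
  adjoint against all fields and integrating by parts gives
  \<open>L J (A z)' + \<eta>(A z) = u L J u'' + 2 u' (L J u' + \<lambda>)\<close>. The mean of the right-hand side vanishes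
  because \<open>L J\<close> is skew; therefore \<open>\<lambda>\<close> is constant in time, and the constant in the theorem
  is \<open>-\<lambda>\<close>.
\<close>

section \<open>Smooth periodic functions\<close>

text \<open>A linear map on the reals is determined by its value at 1, so the family of directional
  derivatives in \<open>Ck_on\<close> collapses to the single function \<open>deriv f\<close>. The
  smoothness inductions below run on this form.\<close>

lemma Ck_on_Suc_UNIV_iff:
  fixes f :: "real \<Rightarrow> real"
  shows "Ck_on (Suc k) f UNIV \<longleftrightarrow>
    (\<forall>x. (f has_real_derivative deriv f x) (at x)) \<and> Ck_on k (deriv f) UNIV"
proof
  assume "Ck_on (Suc k) f UNIV"
  then obtain f' where f': "\<And>x. (f has_derivative f' x) (at x)"
    and Ck: "\<And>v. Ck_on k (\<lambda>x. f' x v) UNIV"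
    by auto
  have *: "(f has_real_derivative f' x 1) (at x)" for x
  proof (rule has_derivative_imp_has_field_derivative[OF f'])
    interpret linear "f' x"
      using f' has_derivative_linear by blast
    show "v * f' x 1 = f' x v" for v
      using scaleR[of v 1] by simp
  qed
  then have "deriv f = (\<lambda>x. f' x 1)"
    by (intro ext DERIV_imp_deriv)
  then show "(\<forall>x. (f has_real_derivative deriv f x) (at x)) \<and> Ck_on k (deriv f) UNIV"
    using * Ck[of 1] by simp
next
  \<comment> \<open>The direction v yields the directional derivative v times
    \<open>deriv f\<close>, so closure under scalar multiples is required first; it is derived from
    the raw recursion because the equivalence is still being proved.\<close>
  have cmult: "Ck_on k (\<lambda>x. v * g x) UNIV" if "Ck_on k g UNIV" for k v and g :: "real \<Rightarrow> real"
    using that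
  proof (induction k arbitrary: g)
    case 0
    then show ?case by (auto intro!: continuous_intros)
  next
    case (Suc k)
    then obtain g' where g': "\<And>x. (g has_derivative g' x) (at x)" "\<And>v. Ck_on k (\<lambda>x. g' x v) UNIV"
      by auto
    have "((\<lambda>x. v * g x) has_derivative (\<lambda>w. v * g' x w)) (at x)" for x
      using g'(1) by (rule has_derivative_mult_right)
    moreover have "Ck_on k (\<lambda>x. v * g' x w) UNIV" for w
      using g'(2) by (rule Suc.IH)
    ultimately show ?case
      unfolding Ck_on.simps by (intro exI[of _ "\<lambda>x w. v * g' x w"]) blast
  qed
  assume "(\<forall>x. (f has_real_derivative deriv f x) (at x)) \<and> Ck_on k (deriv f) UNIV"
  then have "(f has_derivative (\<lambda>v. v * deriv f x)) (at x)" "Ck_on k (\<lambda>x. v * deriv f x) UNIV" for x v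
    using cmult[of k "deriv f" v] by (simp_all add: has_field_derivative_def mult.commute[of _ "deriv f x"])
  then show "Ck_on (Suc k) f UNIV"
    unfolding Ck_on.simps by (intro exI[of _ "\<lambda>x v. v * deriv f x"]) blast
qed

text \<open>The product rule leaves undifferentiated factors, which are given at level
  \<open>Suc k\<close> but enter the induction hypothesis at level \<open>k\<close>.\<close>

lemma Ck_on_Suc_imp:
  fixes f :: "real \<Rightarrow> real"
  shows "Ck_on (Suc k) f UNIV \<Longrightarrow> Ck_on k f UNIV"
proof (induction k arbitrary: f)
  case 0
  then show ?case
    unfolding Ck_on_Suc_UNIV_iff by (auto intro: DERIV_continuous_on)
next
  case (Suc k)
  then show ?case
    unfolding Ck_on_Suc_UNIV_iff[of "Suc k"] Ck_on_Suc_UNIV_iff[of k] by auto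
qed

lemma Ck_on_const: "Ck_on k (\<lambda>x::real. c::real) UNIV"
  by (induction k arbitrary: c) (simp_all add: Ck_on_Suc_UNIV_iff del: Ck_on.simps(2))

lemma Ck_on_add:
  fixes f g :: "real \<Rightarrow> real"
  shows "Ck_on k f UNIV \<Longrightarrow> Ck_on k g UNIV \<Longrightarrow> Ck_on k (\<lambda>x. f x + g x) UNIV"
proof (induction k arbitrary: f g)
  case 0
  then show ?case by (auto intro!: continuous_intros)
next
  case (Suc k)
  have *: "((\<lambda>x. f x + g x) has_real_derivative (deriv f x + deriv g x)) (at x)" for x
    using Suc.prems unfolding Ck_on_Suc_UNIV_iff by (intro DERIV_add) blast+
  then have deriv: "deriv (\<lambda>x. f x + g x) = (\<lambda>x. deriv f x + deriv g x)"
    by (intro ext DERIV_imp_deriv)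
  have "Ck_on k (\<lambda>x. deriv f x + deriv g x) UNIV"
    using Suc.prems unfolding Ck_on_Suc_UNIV_iff by (intro Suc.IH) blast+
  with * show ?case
    unfolding Ck_on_Suc_UNIV_iff deriv by blast
qed

lemma Ck_on_mult:
  fixes f g :: "real \<Rightarrow> real"
  shows "Ck_on k f UNIV \<Longrightarrow> Ck_on k g UNIV \<Longrightarrow> Ck_on k (\<lambda>x. f x * g x) UNIV"
proof (induction k arbitrary: f g)
  case 0
  then show ?case by (auto intro!: continuous_intros)
next
  case (Suc k)
  have *: "((\<lambda>x. f x * g x) has_real_derivative (deriv f x * g x + f x * deriv g x)) (at x)" for x
    using Suc.prems DERIV_mult[of f "deriv f x" x UNIV g "deriv g x"]
    unfolding Ck_on_Suc_UNIV_iff by (simp add: mult.commute)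
  then have deriv: "deriv (\<lambda>x. f x * g x) = (\<lambda>x. deriv f x * g x + f x * deriv g x)"
    by (intro ext DERIV_imp_deriv)
  have "Ck_on k (\<lambda>x. deriv f x * g x + f x * deriv g x) UNIV"
    using Suc.prems Suc.prems[THEN Ck_on_Suc_imp]
    unfolding Ck_on_Suc_UNIV_iff by (intro Ck_on_add Suc.IH) blast+
  with * show ?case
    unfolding Ck_on_Suc_UNIV_iff deriv by blast
qed

section \<open>Smooth periodic fields as an algebra closed under differentiation\<close>

lemma Vect_iff:
  "x \<in> Vect \<longleftrightarrow> (\<forall>k. Ck_on k x UNIV) \<and> (\<forall>\<theta>. x (\<theta> + 2 * pi) = x \<theta>)"
  by (simp add: Vect_def smooth_on_def)

lemma Vect_periodic: "x \<in> Vect \<Longrightarrow> x (\<theta> + 2 * pi) = x \<theta>"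
  by (simp add: Vect_iff)

lemma Vect_has_deriv: "x \<in> Vect \<Longrightarrow> (x has_real_derivative deriv x \<theta>) (at \<theta>)"
  using Ck_on_Suc_UNIV_iff[of 0 x] by (simp add: Vect_iff del: Ck_on.simps)

lemma Vect_continuous_on: "x \<in> Vect \<Longrightarrow> continuous_on S x"
  using Vect_has_deriv DERIV_isCont continuous_at_imp_continuous_on by blast

lemma Vect_const: "(\<lambda>\<theta>. c) \<in> Vect"
  by (simp add: Vect_iff Ck_on_const)

lemma Vect_add: "x \<in> Vect \<Longrightarrow> y \<in> Vect \<Longrightarrow> (\<lambda>\<theta>. x \<theta> + y \<theta>) \<in> Vect"
  by (auto simp: Vect_iff intro: Ck_on_add)

lemma Vect_mult: "x \<in> Vect \<Longrightarrow> y \<in> Vect \<Longrightarrow> (\<lambda>\<theta>. x \<theta> * y \<theta>) \<in> Vect"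
  by (auto simp: Vect_iff intro: Ck_on_mult)

lemma Vect_diff: "x \<in> Vect \<Longrightarrow> y \<in> Vect \<Longrightarrow> (\<lambda>\<theta>. x \<theta> - y \<theta>) \<in> Vect"
  using Vect_add[OF _ Vect_mult[OF Vect_const[of "-1"]], of x y] by simp

lemma Vect_deriv:
  assumes "x \<in> Vect"
  shows "deriv x \<in> Vect"
proof -
  have "deriv x (\<theta> + 2 * pi) = deriv x \<theta>" for \<theta>
  proof -
    have "((\<lambda>\<theta>. x (\<theta> + 2 * pi)) has_real_derivative deriv x (\<theta> + 2 * pi)) (at \<theta>)"
      using Vect_has_deriv[OF assms] DERIV_shift by blast
    then show ?thesis
      using Vect_periodic[OF assms] DERIV_imp_deriv by fastforce
  qed
  moreover have "Ck_on k (deriv x) UNIV" for k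
    using assms Ck_on_Suc_UNIV_iff[of k x] by (simp add: Vect_iff del: Ck_on.simps)
  ultimately show ?thesis
    by (simp add: Vect_iff)
qed

lemmas Vect_intros = Vect_const Vect_add Vect_mult Vect_diff Vect_deriv

lemma deriv_Vect_mult:
  assumes "x \<in> Vect" "y \<in> Vect"
  shows "deriv (\<lambda>\<theta>. x \<theta> * y \<theta>) = (\<lambda>\<theta>. deriv x \<theta> * y \<theta> + x \<theta> * deriv y \<theta>)"
  by (intro ext DERIV_imp_deriv) (auto intro!: derivative_eq_intros assms Vect_has_deriv)

lemma deriv_Vect_add_const:
  assumes "x \<in> Vect"
  shows "deriv (\<lambda>\<theta>. x \<theta> + c) = deriv x"
  by (intro ext DERIV_imp_deriv) (auto intro!: derivative_eq_intros assms Vect_has_deriv)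

section \<open>Translating integrals of periodic functions\<close>

lemma has_integral_shift:
  fixes f :: "real \<Rightarrow> real"
  assumes "(f has_integral i) {a..b}"
  shows "((\<lambda>x. f (x + c)) has_integral i) {a - c..b - c}"
  using has_integral_affinity'[of f i a b 1 c] assms by simp

text \<open>Moving b by whole periods gives a point c of [a, a + p]. Cutting [a, a + p] at c and
  moving the left piece one period to the right gives [c, c + p]. No continuity is assumed, since
  the integrand in \<open>J_eq\<close> that is cut off near the singularities jumps.\<close>

lemma has_integral_period:
  fixes f :: "real \<Rightarrow> real"
  assumes per: "\<And>t. f (t + p) = f t" and "p > 0" and int: "(f has_integral i) {a..a + p}"
  shows "(f has_integral i) {b..b + p}"
proof -
  have per': "f (t + p * of_int k) = f t" for t and k :: int
  proof (induction k arbitrary: t rule: int_induct[where k = 0])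
    case (step1 k)
    then show ?case using per[of "t + p * of_int k"] by (simp add: algebra_simps)
  next
    case (step2 k)
    then show ?case using per[of "t + p * of_int (k - 1)"] by (simp add: algebra_simps)
  qed simp
  define k where "k = \<lfloor>(b - a) / p\<rfloor>"
  define c where "c = b - p * of_int k"
  have "of_int k \<le> (b - a) / p" "(b - a) / p < of_int k + 1"
    by (simp_all add: k_def)
  then have c: "a \<le> c" "c \<le> a + p"
    using \<open>p > 0\<close> by (simp_all add: c_def field_simps)
  have fint: "f integrable_on {a..a + p}"
    using int by blast
  have "f integrable_on {a..c}" "f integrable_on {c..a + p}"
    by (rule integrable_subinterval_real[OF fint]; use c in auto)+
  then obtain i1 i2 where i1: "(f has_integral i1) {a..c}" and i2: "(f has_integral i2) {c..a + p}"
    by blast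
  have i: "i = i1 + i2"
    using has_integral_combine[OF c i1 i2] int has_integral_unique by blast
  have "(f has_integral i1) {a + p..c + p}"
    using has_integral_shift[OF i1, of "-p"] per[of "_ - p"] by simp
  then have "(f has_integral i) {c..c + p}"
    using has_integral_combine[OF _ _ i2, of "c + p"] c by (simp add: i add.commute)
  from has_integral_shift[OF this, of "- p * of_int k"] show ?thesis
    using per'[of _ "- k"] by (simp add: c_def)
qed


section \<open>The Hilbert transform\<close>

text \<open>
  The continuous extension to \<open>s = 0\<close> of the symmetrized integrand, written with the factor
  \<open>(x (\<theta> + s) - x (\<theta> - s)) / s\<close> as an integral of \<open>x'\<close>, which makes joint continuity visible.
\<close>

definition cot_quot :: "(real \<Rightarrow> real) \<Rightarrow> real \<Rightarrow> real \<Rightarrow> real" where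
  "cot_quot x \<theta> s =
     (if s = 0 then 2 else s * cot (s / 2)) * integral {-1..1} (\<lambda>r. deriv x (\<theta> + s * r))"

text \<open>An antiderivative of x'(\<theta> + s r) in r is x(\<theta> + s r) / s; the factor s in
  front then cancels the denominator.\<close>

lemma cot_quot_eq:
  assumes "x \<in> Vect" "s > 0"
  shows "cot_quot x \<theta> s = (x (\<theta> + s) - x (\<theta> - s)) * cot (s / 2)"
proof -
  have "((\<lambda>r. deriv x (\<theta> + s * r)) has_integral x (\<theta> + s * 1) / s - x (\<theta> + s * (-1)) / s) {-1..1}"
  proof (rule fundamental_theorem_of_calculus)
    fix r :: real
    have "((\<lambda>r. x (\<theta> + s * r) / s) has_real_derivative deriv x (\<theta> + s * r)) (at r)"
      using \<open>s > 0\<close>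
      by (auto intro!: derivative_eq_intros DERIV_chain'[OF _ Vect_has_deriv[OF assms(1)]])
    then show "((\<lambda>r. x (\<theta> + s * r) / s) has_vector_derivative deriv x (\<theta> + s * r))
        (at r within {-1..1})"
      using has_real_derivative_iff_has_vector_derivative has_vector_derivative_at_within by blast
  qed simp
  from integral_unique[OF this]
  have "s * integral {-1..1} (\<lambda>r. deriv x (\<theta> + s * r)) = x (\<theta> + s) - x (\<theta> - s)"
    using \<open>s > 0\<close> by (simp add: field_simps)
  moreover have "cot_quot x \<theta> s = s * integral {-1..1} (\<lambda>r. deriv x (\<theta> + s * r)) * cot (s / 2)"
    using \<open>s > 0\<close> by (simp add: cot_quot_def)
  ultimately show ?thesis
    by simp
qed

text \<open>The quotient sin(s/2) / s tends to the derivative 1/2 of sin(s/2) at 0, which explains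
  the value 2 there; for 0 < s \<le> pi the sine does not vanish.\<close>

lemma continuous_on_mult_cot: "continuous_on {0..pi} (\<lambda>s. if s = 0 then 2 else s * cot (s / 2))"
  unfolding continuous_on_def
proof
  fix s :: real
  assume s: "s \<in> {0..pi}"
  show "((\<lambda>s. if s = 0 then 2 else s * cot (s / 2)) \<longlongrightarrow> (if s = 0 then 2 else s * cot (s / 2)))
      (at s within {0..pi})"
  proof (cases "s = 0")
    case True
    have "((\<lambda>s::real. sin (s / 2)) has_real_derivative 1 / 2) (at 0)"
      by (auto intro!: derivative_eq_intros)
    then have sin: "((\<lambda>s::real. sin (s / 2) / s) \<longlongrightarrow> 1 / 2) (at 0)"
      by (simp add: DERIV_def)
    have cos: "((\<lambda>s::real. cos (s / 2)) \<longlongrightarrow> cos (0 / 2)) (at 0)"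
      by (intro tendsto_intros) auto
    have "((\<lambda>s::real. cos (s / 2) / (sin (s / 2) / s)) \<longlongrightarrow> 2) (at 0)"
      using tendsto_divide[OF cos sin] by simp
    moreover have "eventually (\<lambda>s::real. cos (s / 2) / (sin (s / 2) / s) =
        (if s = 0 then 2 else s * cot (s / 2))) (at 0)"
      by (simp add: cot_def eventually_at_filter)
    ultimately have "((\<lambda>s::real. if s = 0 then 2 else s * cot (s / 2)) \<longlongrightarrow> 2) (at 0)"
      by (rule Lim_transform_eventually)
    then show ?thesis
      using True by (auto intro: tendsto_within_subset)
  next
    case False
    with s have "sin (s / 2) \<noteq> 0"
      using sin_gt_zero[of "s / 2"] by auto
    then have lim: "((\<lambda>s. s * cot (s / 2)) \<longlongrightarrow> s * cot (s / 2)) (at s within {0..pi})"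
      by (intro tendsto_intros) auto
    have "eventually (\<lambda>s'. s' * cot (s' / 2) = (if s' = 0 then 2 else s' * cot (s' / 2)))
        (at s within {0..pi})"
      using eventually_neq_at_within[of 0 s] by eventually_elim simp
    from Lim_transform_eventually[OF lim this] show ?thesis
      using False by simp
  qed
qed

text \<open>Joint continuity justifies both differentiation under the integral in
  \<open>J_has_deriv\<close> and the exchange of integrals in \<open>J_skew\<close>.\<close>

lemma continuous_on_cot_quot:
  assumes "x \<in> Vect"
  shows "continuous_on (UNIV \<times> {0..pi}) (\<lambda>(\<theta>, s). cot_quot x \<theta> s)"
proof -
  have "continuous_on UNIV (\<lambda>p. integral (cbox (-1) 1) (\<lambda>r. deriv x (fst p + snd p * r)))"
    by (rule integral_continuous_on_param)
      (auto simp: case_prod_beta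
        intro!: continuous_intros continuous_on_compose2[OF Vect_continuous_on[OF Vect_deriv[OF assms], of UNIV]])
  then have 1: "continuous_on (UNIV \<times> {0..pi}) (\<lambda>p. integral {-1..1} (\<lambda>r. deriv x (fst p + snd p * r)))"
    using continuous_on_subset by (simp, blast)
  have 2: "continuous_on (UNIV \<times> {0..pi}) (\<lambda>p::real \<times> real. if snd p = 0 then 2 else snd p * cot (snd p / 2))"
    by (rule continuous_on_compose2[OF continuous_on_mult_cot]) (auto intro!: continuous_intros)
  show ?thesis
    using continuous_on_mult[OF 2 1] by (simp add: cot_quot_def case_prod_beta)
qed

lemma continuous_on_cot_quot_snd:
  assumes "x \<in> Vect"
  shows "continuous_on {0..pi} (cot_quot x \<theta>)"
  by (rule continuous_on_compose2[OF continuous_on_cot_quot[OF assms], of _ "\<lambda>s. (\<theta>, s)", simplified])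
    (auto intro!: continuous_intros)

text \<open>By periodicity the window [0, 2 pi] can be recentred at \<theta>, where the excised set
  is |s| < \<epsilon>. Since cot is odd, the two halves combine into the integral of
  \<open>cot_quot\<close> over [\<epsilon>, pi]. Its integrand is continuous up to 0, so the limit
  exists and equals the full integral.\<close>

lemma J_eq:
  assumes x: "x \<in> Vect"
  shows "J x \<theta> = 1 / (2 * pi) * integral {0..pi} (cot_quot x \<theta>)"
proof -
  define E where "E \<epsilon> = {t. \<forall>k::int. \<epsilon> \<le> \<bar>t - \<theta> - 2 * pi * of_int k\<bar>}" for \<epsilon>
  have cutoff: "integral {t \<in> {0..2 * pi}. \<forall>k::int. \<epsilon> \<le> \<bar>t - \<theta> - 2 * pi * of_int k\<bar>}
      (\<lambda>t. x t / tan ((t - \<theta>) / 2)) = integral {\<epsilon>..pi} (cot_quot x \<theta>)"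
    if \<epsilon>: "0 < \<epsilon>" "\<epsilon> < pi" for \<epsilon>
  proof -
    \<comment> \<open>Extending the integrand by zero over the excised neighbourhoods of all
      singularities makes it periodic on the whole line, so \<open>has_integral_period\<close>
      applies.\<close>
    define g where "g t = (if t \<in> E \<epsilon> then x t * cot ((t - \<theta>) / 2) else 0)" for t
    have shift_E: "t + 2 * pi \<in> E \<epsilon> \<longleftrightarrow> t \<in> E \<epsilon>" for t
    proof
      assume a: "t + 2 * pi \<in> E \<epsilon>"
      have "\<epsilon> \<le> \<bar>t - \<theta> - 2 * pi * of_int k\<bar>" for k
        using a[unfolded E_def mem_Collect_eq, rule_format, of "k + 1"] by (simp add: algebra_simps)
      then show "t \<in> E \<epsilon>" by (simp add: E_def)
    next
      assume a: "t \<in> E \<epsilon>"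
      have "\<epsilon> \<le> \<bar>t + 2 * pi - \<theta> - 2 * pi * of_int k\<bar>" for k
        using a[unfolded E_def mem_Collect_eq, rule_format, of "k - 1"] by (simp add: algebra_simps)
      then show "t + 2 * pi \<in> E \<epsilon>" by (simp add: E_def)
    qed
    have "cot ((t + 2 * pi - \<theta>) / 2) = cot ((t - \<theta>) / 2)" for t
    proof -
      have "(t + 2 * pi - \<theta>) / 2 = (t - \<theta>) / 2 + pi" by (simp add: field_simps)
      then show ?thesis by (simp only: cot_def sin_periodic_pi cos_periodic_pi minus_divide_divide)
    qed
    then have per: "g (t + 2 * pi) = g t" for t
      by (simp add: g_def shift_E Vect_periodic[OF x])
    \<comment> \<open>Within half a period of \<theta> only the singularity with k = 0 matters: the
      others are at distance at least 2 pi - pi, which exceeds \<epsilon>.\<close>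
    have E_near: "\<theta> + s \<in> E \<epsilon> \<longleftrightarrow> \<epsilon> \<le> \<bar>s\<bar>" if "\<bar>s\<bar> \<le> pi" for s
    proof
      assume "\<theta> + s \<in> E \<epsilon>"
      then show "\<epsilon> \<le> \<bar>s\<bar>"
        unfolding E_def by (auto dest: spec[of _ 0])
    next
      assume s: "\<epsilon> \<le> \<bar>s\<bar>"
      have "\<epsilon> \<le> \<bar>s - 2 * pi * of_int k\<bar>" for k :: int
      proof (cases "k = 0")
        case False
        then have "1 \<le> \<bar>of_int k :: real\<bar>" by linarith
        then have "2 * pi \<le> \<bar>2 * pi * of_int k\<bar>"
          by (simp add: abs_mult)
        with that \<epsilon> show ?thesis by linarith
      qed (use s in simp)
      then show "\<theta> + s \<in> E \<epsilon>" by (simp add: E_def)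
    qed
    have cont_cot: "continuous_on {\<epsilon>..pi} (\<lambda>s. cot (s / 2))"
      unfolding cot_def
    proof (intro continuous_intros ballI)
      show "sin (s / 2) \<noteq> 0" if "s \<in> {\<epsilon>..pi}" for s
        using that \<epsilon> sin_gt_zero[of "s / 2"] by simp
    qed auto
    have "continuous_on {\<epsilon>..pi} (\<lambda>s. x (\<theta> + s) * cot (s / 2))"
      "continuous_on {\<epsilon>..pi} (\<lambda>s. x (\<theta> - s) * cot (s / 2))"
      by (auto intro!: continuous_intros cont_cot continuous_on_compose2[OF Vect_continuous_on[OF x, of UNIV]])
    then obtain i j where i: "((\<lambda>s. x (\<theta> + s) * cot (s / 2)) has_integral i) {\<epsilon>..pi}"
      and j: "((\<lambda>s. x (\<theta> - s) * cot (s / 2)) has_integral j) {\<epsilon>..pi}"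
      using integrable_continuous_real by blast
    have "((\<lambda>s. g (\<theta> + s)) has_integral i) {\<epsilon>..pi}"
      using i by (rule has_integral_eq[rotated]) (use \<epsilon> in \<open>auto simp: g_def E_near\<close>)
    \<comment> \<open>The endpoints belong to \<open>E \<epsilon>\<close>, so the integrand vanishes
      only up to these two points.\<close>
    moreover have "((\<lambda>s. g (\<theta> + s)) has_integral 0) {-\<epsilon>..\<epsilon>}"
      by (rule has_integral_spike_finite[of "{-\<epsilon>, \<epsilon>}" _ _ "\<lambda>_. 0"])
        (use \<epsilon> in \<open>auto simp: g_def E_near\<close>)
    moreover have "((\<lambda>s. g (\<theta> + s)) has_integral - j) {-pi..-\<epsilon>}"
    proof -
      have "((\<lambda>s. x (\<theta> + s) * cot (- s / 2)) has_integral j) {-pi..-\<epsilon>}"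
        using j has_integral_reflect_real[of "\<lambda>s. x (\<theta> - s) * cot (s / 2)" j pi \<epsilon>] by simp
      then have "((\<lambda>s. - (x (\<theta> + s) * cot (- s / 2))) has_integral - j) {-pi..-\<epsilon>}"
        by (rule has_integral_neg)
      then show ?thesis
        by (rule has_integral_eq[rotated]) (use \<epsilon> in \<open>auto simp: g_def E_near cot_def\<close>)
    qed
    ultimately have "((\<lambda>s. g (\<theta> + s)) has_integral (- j + 0) + i) {-pi..pi}"
      using \<epsilon> by (intro has_integral_combine[of "-pi" \<epsilon> pi] has_integral_combine[of "-pi" "-\<epsilon>" \<epsilon>]) auto
    then have "(g has_integral i - j) {\<theta> - pi..(\<theta> - pi) + 2 * pi}"
      using has_integral_shift[of "\<lambda>s. g (\<theta> + s)" "i - j" "-pi" pi "- \<theta>"] by (simp add: algebra_simps)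
    from has_integral_period[OF per _ this, of 0] have "(g has_integral i - j) {0..2 * pi}"
      by simp
    then have "((\<lambda>t. x t * cot ((t - \<theta>) / 2)) has_integral i - j) (E \<epsilon> \<inter> {0..2 * pi})"
      unfolding g_def has_integral_restrict_Int .
    moreover have "E \<epsilon> \<inter> {0..2 * pi} = {t \<in> {0..2 * pi}. \<forall>k::int. \<epsilon> \<le> \<bar>t - \<theta> - 2 * pi * of_int k\<bar>}"
      by (auto simp: E_def)
    \<comment> \<open>Where sine or cosine vanishes, division by zero makes both sides 0, so the
      identity holds without exception.\<close>
    moreover have "x t / tan ((t - \<theta>) / 2) = x t * cot ((t - \<theta>) / 2)" for t
      by (simp only: cot_altdef divide_inverse)
    ultimately have 1: "integral {t \<in> {0..2 * pi}. \<forall>k::int. \<epsilon> \<le> \<bar>t - \<theta> - 2 * pi * of_int k\<bar>}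
        (\<lambda>t. x t / tan ((t - \<theta>) / 2)) = i - j"
      by (simp only: integral_unique)
    have "((\<lambda>s. x (\<theta> + s) * cot (s / 2) - x (\<theta> - s) * cot (s / 2)) has_integral i - j) {\<epsilon>..pi}"
      using i j by (rule has_integral_diff)
    then have "(cot_quot x \<theta> has_integral i - j) {\<epsilon>..pi}"
      by (rule has_integral_eq[rotated]) (use \<epsilon> in \<open>auto simp: cot_quot_eq[OF x] algebra_simps\<close>)
    with 1 show ?thesis
      by (simp add: integral_unique)
  qed
  have "continuous_on {0..pi} (\<lambda>\<epsilon>. integral {\<epsilon>..pi} (cot_quot x \<theta>))"
    by (intro indefinite_integral_continuous_1' integrable_continuous_real continuous_on_cot_quot_snd x)
  then have "((\<lambda>\<epsilon>. integral {\<epsilon>..pi} (cot_quot x \<theta>)) \<longlongrightarrow> integral {0..pi} (cot_quot x \<theta>)) (at 0 within {0..pi})"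
    by (simp add: continuous_on_def)
  then have lim: "((\<lambda>\<epsilon>. integral {\<epsilon>..pi} (cot_quot x \<theta>)) \<longlongrightarrow> integral {0..pi} (cot_quot x \<theta>)) (at_right 0)"
    by (simp add: at_within_Icc_at_right)
  have "eventually (\<lambda>\<epsilon>. \<epsilon> \<in> {0<..<pi}) (at_right 0)"
    by (rule eventually_at_right_real) simp
  then have "eventually (\<lambda>\<epsilon>. integral {\<epsilon>..pi} (cot_quot x \<theta>) =
      integral {t \<in> {0..2 * pi}. \<forall>k::int. \<epsilon> \<le> \<bar>t - \<theta> - 2 * pi * of_int k\<bar>}
        (\<lambda>t. x t / tan ((t - \<theta>) / 2))) (at_right 0)"
    by eventually_elim (simp only: cutoff greaterThanLessThan_iff)
  from tendsto_Lim[OF _ Lim_transform_eventually[OF lim this]] show ?thesis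
    by (simp add: J_def)
qed

text \<open>\<open>cot_quot\<close> is linear in x and commutes with translations in \<theta>, so
  differentiating under the integral replaces x by x'.\<close>

lemma J_has_deriv:
  assumes x: "x \<in> Vect"
  shows "(J x has_real_derivative J (deriv x) \<theta>) (at \<theta>)"
proof -
  have "((\<lambda>\<theta>. integral (cbox 0 pi) (cot_quot x \<theta>)) has_real_derivative
      integral (cbox 0 pi) (cot_quot (deriv x) \<theta>)) (at \<theta> within UNIV)"
  proof (rule leibniz_rule_field_derivative)
    show "((\<lambda>\<theta>. cot_quot x \<theta> s) has_real_derivative cot_quot (deriv x) \<theta> s) (at \<theta> within UNIV)"
      if "s \<in> cbox 0 pi" for \<theta> s
    proof (cases "s = 0")
      case True
      \<comment> \<open>At s = 0 the prefactor 2 and the length 2 of [-1, 1] combine to 4.\<close>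
      have "((\<lambda>\<theta>. 4 * deriv x \<theta>) has_real_derivative 4 * deriv (deriv x) \<theta>) (at \<theta>)"
        by (intro DERIV_cmult Vect_has_deriv Vect_deriv x)
      with True show ?thesis by (simp add: cot_quot_def)
    next
      case False
      with that have s: "s > 0" by simp
      have "((\<lambda>\<theta>. (x (\<theta> + s) - x (\<theta> - s)) * cot (s / 2)) has_real_derivative
          (deriv x (\<theta> + s) - deriv x (\<theta> - s)) * cot (s / 2)) (at \<theta>)"
        by (auto intro!: derivative_eq_intros DERIV_chain'[OF _ Vect_has_deriv[OF x]])
      then show ?thesis
        by (simp add: cot_quot_eq[OF x s] cot_quot_eq[OF Vect_deriv[OF x] s])
    qed
    show "cot_quot x \<theta> integrable_on cbox 0 pi" for \<theta>
      by (simp add: integrable_continuous_real continuous_on_cot_quot_snd x)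
    show "continuous_on (UNIV \<times> cbox 0 pi) (\<lambda>(\<theta>, s). cot_quot (deriv x) \<theta> s)"
      using continuous_on_cot_quot[OF Vect_deriv[OF x]] by simp
  qed auto
  then have "((\<lambda>\<theta>. 1 / (2 * pi) * integral {0..pi} (cot_quot x \<theta>)) has_real_derivative
      1 / (2 * pi) * integral {0..pi} (cot_quot (deriv x) \<theta>)) (at \<theta>)"
    by (intro DERIV_cmult) simp
  then show ?thesis
    using J_eq[OF x] J_eq[OF Vect_deriv[OF x]] by presburger
qed

lemma deriv_J: "x \<in> Vect \<Longrightarrow> deriv (J x) = J (deriv x)"
  by (intro ext DERIV_imp_deriv J_has_deriv)

text \<open>The derivative of \<open>J x\<close> is \<open>J\<close> of another field in
  \<open>Vect\<close>, so the induction on the order of differentiability must range over all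
  x.\<close>

lemma Vect_J:
  assumes "x \<in> Vect"
  shows "J x \<in> Vect"
proof -
  have "Ck_on k (J x) UNIV" for k
    using assms
  proof (induction k arbitrary: x)
    case 0
    then show ?case
      by (auto intro!: DERIV_continuous_on J_has_deriv)
  next
    case (Suc k)
    show ?case
      unfolding Ck_on_Suc_UNIV_iff deriv_J[OF Suc.prems]
      using J_has_deriv[OF Suc.prems] Suc.IH[OF Vect_deriv[OF Suc.prems]] by blast
  qed
  moreover have "cot_quot x (\<theta> + 2 * pi) = cot_quot x \<theta>" for \<theta>
  proof -
    have "deriv x (\<theta> + 2 * pi + r) = deriv x (\<theta> + r)" for r
      using Vect_periodic[OF Vect_deriv[OF assms], of "\<theta> + r"] by (simp add: ac_simps)
    then show ?thesis
      unfolding cot_quot_def by presburger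
  qed
  ultimately show ?thesis
    by (simp add: Vect_iff J_eq[OF assms])
qed


section \<open>The pairing and the inner product\<close>

lemma eta_add:
  assumes "continuous_on UNIV x" "continuous_on UNIV y"
  shows "eta (\<lambda>\<theta>. x \<theta> + y \<theta>) = eta x + eta y"
proof -
  have "x integrable_on {0..2 * pi}" "y integrable_on {0..2 * pi}"
    using assms by (auto intro: integrable_continuous_real continuous_on_subset)
  then show ?thesis
    by (simp add: eta_def Henstock_Kurzweil_Integration.integral_add field_simps)
qed

lemma eta_mult_left: "eta (\<lambda>\<theta>. c * x \<theta>) = c * eta x"
  by (simp add: eta_def)

lemma eta_diff:
  assumes "continuous_on UNIV x" "continuous_on UNIV y"
  shows "eta (\<lambda>\<theta>. x \<theta> - y \<theta>) = eta x - eta y"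
  using eta_add[OF assms(1), of "\<lambda>\<theta>. - y \<theta>"] eta_mult_left[of "-1" y] assms(2)
  by (simp add: continuous_on_minus)

lemma eta_const: "eta (\<lambda>\<theta>. c) = c"
  by (simp add: eta_def)

lemma eta_shift:
  assumes "continuous_on UNIV x" and per: "\<And>\<theta>. x (\<theta> + 2 * pi) = x \<theta>"
  shows "eta (\<lambda>\<theta>. x (\<theta> + c)) = eta x"
proof -
  have "(x has_integral integral {0..2 * pi} x) {0..0 + 2 * pi}"
    using assms(1) by (auto intro!: integrable_integral integrable_continuous_real intro: continuous_on_subset)
  then have "(x has_integral integral {0..2 * pi} x) {c..c + 2 * pi}"
    using has_integral_period[of x "2 * pi" _ 0 c, OF per] by simp
  from has_integral_shift[OF this, of c] show ?thesis
    by (simp add: eta_def integral_unique)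
qed

lemma eta_deriv:
  assumes "x \<in> Vect"
  shows "eta (deriv x) = 0"
proof -
  have "(deriv x has_integral x (2 * pi) - x 0) {0..2 * pi}"
    using Vect_has_deriv[OF assms]
    by (intro fundamental_theorem_of_calculus)
      (auto simp: has_real_derivative_iff_has_vector_derivative[symmetric] intro: has_field_derivative_at_within)
  then show ?thesis
    using Vect_periodic[OF assms, of 0] by (simp add: eta_def integral_unique)
qed

lemma eta_by_parts:
  assumes "x \<in> Vect" "y \<in> Vect"
  shows "eta (\<lambda>\<theta>. deriv x \<theta> * y \<theta>) = - eta (\<lambda>\<theta>. x \<theta> * deriv y \<theta>)"
  using eta_deriv[OF Vect_mult[OF assms]]
    eta_add[of "\<lambda>\<theta>. deriv x \<theta> * y \<theta>" "\<lambda>\<theta>. x \<theta> * deriv y \<theta>"]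
  by (simp add: deriv_Vect_mult assms Vect_continuous_on Vect_intros)

text \<open>Translation invariance of the mean turns a shift of x by s into a shift of y by -s. This
  exchanges the two terms of the difference and hence its sign. The limiting case s = 0 is
  integration by parts.\<close>

lemma cot_quot_skew:
  assumes x: "x \<in> Vect" and y: "y \<in> Vect" and "s \<ge> 0"
  shows "eta (\<lambda>\<theta>. cot_quot x \<theta> s * y \<theta>) = - eta (\<lambda>\<theta>. x \<theta> * cot_quot y \<theta> s)"
proof (cases "s = 0")
  case True
  then show ?thesis
    using eta_by_parts[OF x y] eta_mult_left[of 4 "\<lambda>\<theta>. deriv x \<theta> * y \<theta>"]
      eta_mult_left[of 4 "\<lambda>\<theta>. x \<theta> * deriv y \<theta>"]
    by (simp add: cot_quot_def ac_simps)
next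
  case False
  then have s: "s > 0"
    using \<open>s \<ge> 0\<close> by simp
  have cont: "continuous_on UNIV (\<lambda>\<theta>. z (\<theta> + c))" if "z \<in> Vect" for z c
    by (rule continuous_on_compose2[OF Vect_continuous_on[OF that, of UNIV]])
      (auto intro!: continuous_intros)
  have per: "z (\<theta> + 2 * pi + c) = z (\<theta> + c)" if "z \<in> Vect" for z \<theta> c
    using Vect_periodic[OF that, of "\<theta> + c"] by (simp add: ac_simps)
  have shift: "eta (\<lambda>\<theta>. x (\<theta> + c) * y \<theta>) = eta (\<lambda>\<theta>. x \<theta> * y (\<theta> + - c))" for c
    using eta_shift[of "\<lambda>\<theta>. x (\<theta> + c) * y \<theta>" "- c"]
    by (simp add: continuous_on_mult cont Vect_continuous_on per Vect_periodic x y)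
  have "eta (\<lambda>\<theta>. cot_quot x \<theta> s * y \<theta>) =
      cot (s / 2) * eta (\<lambda>\<theta>. x (\<theta> + s) * y \<theta> - x (\<theta> + - s) * y \<theta>)"
    by (simp add: cot_quot_eq[OF x s] algebra_simps flip: eta_mult_left)
  also have "\<dots> = cot (s / 2) * eta (\<lambda>\<theta>. x \<theta> * y (\<theta> + - s) - x \<theta> * y (\<theta> + s))"
    using shift[of s] shift[of "- s"]
    by (subst (1 2) eta_diff)
      (auto intro!: continuous_on_mult cont Vect_continuous_on[OF x] Vect_continuous_on[OF y] x y
        simp del: add_uminus_conv_diff)
  also have "\<dots> = eta (\<lambda>\<theta>. - 1 * (x \<theta> * cot_quot y \<theta> s))"
    by (simp add: cot_quot_eq[OF y s] algebra_simps flip: eta_mult_left)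
  also have "\<dots> = - eta (\<lambda>\<theta>. x \<theta> * cot_quot y \<theta> s)"
    by (simp only: eta_mult_left)
  finally show ?thesis .
qed

text \<open>Exchanging the integrals over \<theta> and s reduces skewness to that of
  \<open>cot_quot\<close> at each fixed s.\<close>

lemma J_skew:
  assumes x: "x \<in> Vect" and y: "y \<in> Vect"
  shows "eta (\<lambda>\<theta>. J x \<theta> * y \<theta>) = - eta (\<lambda>\<theta>. x \<theta> * J y \<theta>)"
proof -
  have swap: "eta (\<lambda>\<theta>. J x \<theta> * y \<theta>) = 1 / (2 * pi) * integral {0..pi} (\<lambda>s. eta (\<lambda>\<theta>. cot_quot x \<theta> s * y \<theta>))"
    if x: "x \<in> Vect" and y: "y \<in> Vect" for x y
  proof -
    have "continuous_on (UNIV \<times> {0..pi}) (\<lambda>p. cot_quot x (fst p) (snd p) * y (fst p))"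
      using continuous_on_cot_quot[OF x]
      by (auto simp: case_prod_beta
        intro!: continuous_intros continuous_on_compose2[OF Vect_continuous_on[OF y, of UNIV]])
    then have "continuous_on (cbox (0, 0) (2 * pi, pi)) (\<lambda>(\<theta>, s). cot_quot x \<theta> s * y \<theta>)"
      unfolding case_prod_beta by (rule continuous_on_subset) (auto simp: cbox_Pair_eq)
    from integral_swap_continuous[OF this]
    have "integral {0..2 * pi} (\<lambda>\<theta>. integral {0..pi} (cot_quot x \<theta>) * y \<theta>) =
        integral {0..pi} (\<lambda>s. integral {0..2 * pi} (\<lambda>\<theta>. cot_quot x \<theta> s * y \<theta>))"
      by simp
    then show ?thesis
      by (simp add: eta_def J_eq[OF x])
  qed
  have "eta (\<lambda>\<theta>. cot_quot x \<theta> s * y \<theta>) = - eta (\<lambda>\<theta>. cot_quot y \<theta> s * x \<theta>)" if "s \<ge> 0" for s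
    using cot_quot_skew[OF x y that] by (simp add: mult.commute)
  then have "integral {0..pi} (\<lambda>s. eta (\<lambda>\<theta>. cot_quot x \<theta> s * y \<theta>)) =
      integral {0..pi} (\<lambda>s. - eta (\<lambda>\<theta>. cot_quot y \<theta> s * x \<theta>))"
    by (intro integral_cong) simp
  with swap[OF x y] swap[OF y x] show ?thesis
    by (simp add: mult.commute)
qed

section \<open>The extended inner product as an L2 pairing\<close>

lemma Vect_L: "x \<in> Vect \<Longrightarrow> L \<alpha> \<beta> x \<in> Vect"
  unfolding L_def by (intro Vect_intros)

lemma deriv_L:
  assumes "x \<in> Vect"
  shows "deriv (L \<alpha> \<beta> x) = L \<alpha> \<beta> (deriv x)"
  unfolding L_def
  by (intro ext DERIV_imp_deriv) (auto intro!: derivative_eq_intros assms Vect_has_deriv Vect_deriv)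

text \<open>\<open>J\<close> and the derivative are both skew for the mean pairing, so everything
  acting on x can be moved to y. Moving \<open>J\<close> changes the sign of the \<alpha> term once;
  the \<beta> term changes sign twice, and together they form \<open>L\<close>. The summand
  \<open>eta x * eta y\<close> is the pairing of x with the constant \<open>eta y\<close>.\<close>

lemma ip_eq:
  assumes x: "x \<in> Vect" and y: "y \<in> Vect"
  shows "ip \<alpha> \<beta> x y = eta (\<lambda>\<theta>. x \<theta> * (L \<alpha> \<beta> (J (deriv y)) \<theta> + eta y))"
proof -
  define w where "w = (\<lambda>\<theta>. x \<theta> - eta x)"
  have w: "w \<in> Vect"
    unfolding w_def by (intro Vect_intros x)
  define z where "z = deriv y"
  have z: "z \<in> Vect"
    unfolding z_def by (intro Vect_intros y)
  have dy: "deriv (\<lambda>\<theta>. y \<theta> - eta y) = z"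
    using deriv_Vect_add_const[OF y, of "- eta y"] by (simp add: z_def)
  note [simp] = Vect_continuous_on Vect_intros Vect_J Vect_L x y z w
  have "ip0 \<alpha> \<beta> w (\<lambda>\<theta>. y \<theta> - eta y) = eta (\<lambda>\<theta>. \<alpha> * (J w \<theta> * z \<theta>) + \<beta> * (deriv (J w) \<theta> * deriv z \<theta>))"
    unfolding ip0_def omega_def dy by (simp add: eta_def ac_simps)
  also have "\<dots> = \<alpha> * eta (\<lambda>\<theta>. J w \<theta> * z \<theta>) + \<beta> * eta (\<lambda>\<theta>. deriv (J w) \<theta> * deriv z \<theta>)"
    by (simp add: eta_add eta_mult_left)
  also have "\<dots> = \<beta> * eta (\<lambda>\<theta>. w \<theta> * deriv (deriv (J z)) \<theta>) - \<alpha> * eta (\<lambda>\<theta>. w \<theta> * J z \<theta>)"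
    by (simp add: deriv_J J_skew eta_by_parts)
  also have "\<dots> = eta (\<lambda>\<theta>. \<beta> * (w \<theta> * deriv (deriv (J z)) \<theta>) - \<alpha> * (w \<theta> * J z \<theta>))"
    by (simp add: eta_diff eta_mult_left)
  also have "\<dots> = eta (\<lambda>\<theta>. x \<theta> * L \<alpha> \<beta> (J z) \<theta> - eta x * L \<alpha> \<beta> (J z) \<theta>)"
    by (simp add: w_def L_def algebra_simps)
  \<comment> \<open>The mean of x drops out: \<open>L \<alpha> \<beta> (J z)\<close> is the
    derivative of \<open>L \<alpha> \<beta> (J y)\<close> and so has mean zero.\<close>
  also have "\<dots> = eta (\<lambda>\<theta>. x \<theta> * L \<alpha> \<beta> (J z) \<theta>)"
    using eta_deriv[of "L \<alpha> \<beta> (J y)"]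
    by (simp add: eta_diff eta_mult_left deriv_L deriv_J z_def)
  finally have "ip \<alpha> \<beta> x y = eta (\<lambda>\<theta>. x \<theta> * L \<alpha> \<beta> (J z) \<theta>) + eta (\<lambda>\<theta>. eta y * x \<theta>)"
    by (simp add: ip_def w_def eta_mult_left)
  also have "\<dots> = eta (\<lambda>\<theta>. x \<theta> * L \<alpha> \<beta> (J z) \<theta> + eta y * x \<theta>)"
    by (simp add: eta_add)
  finally show ?thesis
    by (simp add: z_def algebra_simps)
qed

section \<open>The adjoint of \<open>ad\<close> and the geodesic equation\<close>

text \<open>Testing against x itself makes the integral of its square vanish. Moving the period so
  that it starts at \<theta> covers points outside [0, 2 pi] as well.\<close>

lemma Vect_eq_zero:
  assumes x: "x \<in> Vect" and orth: "\<And>y. y \<in> Vect \<Longrightarrow> eta (\<lambda>\<theta>. y \<theta> * x \<theta>) = 0"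
  shows "x \<theta> = 0"
proof -
  have cont: "continuous_on S (\<lambda>\<theta>. x \<theta> * x \<theta>)" for S
    by (intro Vect_continuous_on Vect_intros x)
  have "integral {0..2 * pi} (\<lambda>\<theta>. x \<theta> * x \<theta>) = 0"
    using orth[OF x] by (simp add: eta_def)
  then have "((\<lambda>\<theta>. x \<theta> * x \<theta>) has_integral 0) {0..0 + 2 * pi}"
    using integrable_continuous_real[OF cont] by (simp add: has_integral_iff)
  then have "((\<lambda>\<theta>. x \<theta> * x \<theta>) has_integral 0) {\<theta>..\<theta> + 2 * pi}"
    using has_integral_period[of "\<lambda>\<theta>. x \<theta> * x \<theta>" "2 * pi" 0 0 \<theta>] Vect_periodic[OF x] by simp
  then have "\<forall>\<phi>\<in>{\<theta>..\<theta> + 2 * pi}. x \<phi> * x \<phi> = 0"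
    using integral_eq_0_iff[OF cont, of \<theta> "\<theta> + 2 * pi"] by (simp add: integral_unique)
  then show ?thesis by simp
qed

text \<open>Skewness makes the pairing of any z with \<open>J z\<close> zero; one integration by
  parts brings the second-order term to this form with z = x'. With x replaced by u', this removes
  the nonlinear part of the mean of the geodesic equation.\<close>

lemma LJ_skew:
  assumes "x \<in> Vect"
  shows "eta (\<lambda>\<theta>. x \<theta> * L \<alpha> \<beta> (J x) \<theta>) = 0"
proof -
  note [simp] = Vect_continuous_on Vect_intros Vect_J assms
  have skew: "eta (\<lambda>\<theta>. z \<theta> * J z \<theta>) = 0" if "z \<in> Vect" for z
    using J_skew[OF that that] by (simp add: mult.commute)
  have "eta (\<lambda>\<theta>. x \<theta> * L \<alpha> \<beta> (J x) \<theta>) =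
      eta (\<lambda>\<theta>. \<beta> * (x \<theta> * deriv (deriv (J x)) \<theta>) - \<alpha> * (x \<theta> * J x \<theta>))"
    by (simp add: L_def algebra_simps)
  also have "\<dots> = \<beta> * eta (\<lambda>\<theta>. x \<theta> * deriv (deriv (J x)) \<theta>) - \<alpha> * eta (\<lambda>\<theta>. x \<theta> * J x \<theta>)"
    by (simp add: eta_diff eta_mult_left)
  also have "eta (\<lambda>\<theta>. x \<theta> * deriv (deriv (J x)) \<theta>) = - eta (\<lambda>\<theta>. deriv x \<theta> * J (deriv x) \<theta>)"
    using eta_by_parts[of x "deriv (J x)"] by (simp add: deriv_J)
  finally show ?thesis
    by (simp add: skew)
qed

text \<open>The first conclusion makes the multiplier constant in time; the second is the geodesic
  equation, with c in the role of the multiplier at a fixed time.\<close>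

lemma adjoint_ad_eq:
  fixes c :: real
  assumes u: "u \<in> Vect0" and adj: "is_adjoint_on Vect (ip \<alpha> \<beta>) (ad u) A"
  defines "z \<equiv> (\<lambda>\<theta>. u \<theta> + c)"
  shows "eta (A z) = 0"
    and "L \<alpha> \<beta> (J (deriv (A z))) \<theta> =
      u \<theta> * L \<alpha> \<beta> (J (deriv (deriv u))) \<theta> + 2 * deriv u \<theta> * L \<alpha> \<beta> (J (deriv u)) \<theta> + 2 * c * deriv u \<theta>"
proof -
  have uV: "u \<in> Vect" and "eta u = 0"
    using u by (simp_all add: Vect0_def)
  note [simp] = Vect_continuous_on Vect_intros Vect_J Vect_L uV
  have z: "z \<in> Vect"
    by (simp add: z_def)
  have dz: "deriv z = deriv u" and ez: "eta z = c"
    using \<open>eta u = 0\<close> by (simp_all add: z_def deriv_Vect_add_const eta_add eta_const)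
  have a [simp]: "A z \<in> Vect"
    using adj z by (simp add: is_adjoint_on_def)
  \<comment> \<open>By \<open>ip_eq\<close>, f is the density that represents z = u + c: the inner
    product of y with z is the mean of y f.\<close>
  define f where "f = (\<lambda>\<theta>. L \<alpha> \<beta> (J (deriv u)) \<theta> + c)"
  have f [simp]: "f \<in> Vect"
    by (simp add: f_def)
  have df: "deriv f = L \<alpha> \<beta> (J (deriv (deriv u)))"
    by (simp add: f_def deriv_Vect_add_const deriv_L deriv_J)
  \<comment> \<open>This is u' f + (u f)', the result of moving the derivative off y in the pairing
    of \<open>ad u y\<close> with f.\<close>
  define p where "p = (\<lambda>\<theta>. 2 * deriv u \<theta> * f \<theta> + u \<theta> * deriv f \<theta>)"
  have p [simp]: "p \<in> Vect"
    by (simp add: p_def)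
  \<comment> \<open>Likewise, r represents \<open>A z\<close>, so the adjoint identity says that p
    and r have the same pairing with every y.\<close>
  define r where "r = (\<lambda>\<theta>. L \<alpha> \<beta> (J (deriv (A z))) \<theta> + eta (A z))"
  have r [simp]: "r \<in> Vect"
    by (simp add: r_def)
  have "eta (\<lambda>\<theta>. y \<theta> * (p \<theta> - r \<theta>)) = 0" if y [simp]: "y \<in> Vect" for y
  proof -
    have ad: "ad u y \<in> Vect"
      by (simp add: ad_def)
    have "eta (\<lambda>\<theta>. y \<theta> * r \<theta>) = ip \<alpha> \<beta> y (A z)"
      by (simp add: ip_eq r_def)
    also have "\<dots> = ip \<alpha> \<beta> (ad u y) z"
      using adj z by (simp add: is_adjoint_on_def)
    also have "\<dots> = eta (\<lambda>\<theta>. y \<theta> * (deriv u \<theta> * f \<theta>) - deriv y \<theta> * (u \<theta> * f \<theta>))"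
      by (simp only: ip_eq[OF ad z] dz ez) (simp add: ad_def f_def algebra_simps)
    also have "\<dots> = eta (\<lambda>\<theta>. y \<theta> * (deriv u \<theta> * f \<theta>)) + eta (\<lambda>\<theta>. y \<theta> * deriv (\<lambda>\<theta>. u \<theta> * f \<theta>) \<theta>)"
      by (simp add: eta_diff eta_by_parts)
    also have "\<dots> = eta (\<lambda>\<theta>. y \<theta> * p \<theta>)"
      by (simp add: deriv_Vect_mult p_def algebra_simps flip: eta_add)
    finally show ?thesis
      by (simp add: right_diff_distrib eta_diff)
  qed
  then have "p \<phi> - r \<phi> = 0" for \<phi>
    using Vect_eq_zero[OF Vect_diff[OF p r]] by blast
  then have pr: "p = r"
    by (simp add: fun_eq_iff)
  \<comment> \<open>The first summand of r is a derivative, so only the constant contributes to the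
    mean.\<close>
  have "eta r = eta (A z)"
    using eta_deriv[of "L \<alpha> \<beta> (J (A z))"]
    by (simp add: r_def eta_add eta_const deriv_L deriv_J)
  moreover have "eta p = 0"
  proof -
    \<comment> \<open>In this splitting (u f)' and c u' have mean zero as derivatives, and the
      remaining product is covered by \<open>LJ_skew\<close> at u'.\<close>
    have "p = (\<lambda>\<theta>. (deriv u \<theta> * L \<alpha> \<beta> (J (deriv u)) \<theta> + c * deriv u \<theta>) + deriv (\<lambda>\<theta>. u \<theta> * f \<theta>) \<theta>)"
      unfolding p_def deriv_Vect_mult[OF uV f]
      by (simp add: f_def[THEN fun_cong] fun_eq_iff distrib_left mult.commute)
    then show ?thesis
      by (simp add: eta_add eta_mult_left eta_deriv LJ_skew)
  qed
  ultimately show "eta (A z) = 0"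
    using pr by simp
  then show "L \<alpha> \<beta> (J (deriv (A z))) \<theta> =
      u \<theta> * L \<alpha> \<beta> (J (deriv (deriv u))) \<theta> + 2 * deriv u \<theta> * L \<alpha> \<beta> (J (deriv u)) \<theta> + 2 * c * deriv u \<theta>"
    using fun_cong[OF pr, of \<theta>] by (simp add: p_def r_def f_def[THEN fun_cong] df algebra_simps)
qed

theorem mainTheorem4:
  fixes \<alpha> \<beta> :: real
    and \<gamma> :: "real \<Rightarrow> complex \<Rightarrow> complex"
    and u :: "real \<Rightarrow> real \<Rightarrow> real"
  assumes "\<beta> \<ge> 0"
    and "- \<alpha> < \<beta>"
    and "normal_geodesic \<alpha> \<beta> \<gamma>"
    and "u = logderiv \<gamma>"
  shows "\<exists>lam::real. \<forall>t\<in>{0..1}. \<forall>\<theta>.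
           L \<alpha> \<beta> (J (deriv (\<lambda>\<theta>. dtime (\<lambda>s. u s \<theta>) t))) \<theta> =
             u t \<theta> * L \<alpha> \<beta> (J (deriv (deriv (u t)))) \<theta>
             + 2 * deriv (u t) \<theta> * L \<alpha> \<beta> (J (deriv (u t))) \<theta>
             - 2 * lam * deriv (u t) \<theta>"
proof -
  from assms obtain A l where u: "\<And>t. t \<in> {0..1} \<Longrightarrow> u t \<in> Vect0"
    and l: "smooth_on {0..1} l"
    and adj: "\<And>t. t \<in> {0..1} \<Longrightarrow> is_adjoint_on Vect (ip \<alpha> \<beta>) (ad (u t)) (A t)"
    and du: "\<And>t \<theta>. t \<in> {0..1} \<Longrightarrow> dtime (\<lambda>s. u s \<theta>) t = pr0 (A t (\<lambda>\<theta>. u t \<theta> + l t)) \<theta>"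
    and dl: "\<And>t. t \<in> {0..1} \<Longrightarrow> dtime l t = prk (A t (\<lambda>\<theta>. u t \<theta> + l t))"
    unfolding normal_geodesic_def Let_def by blast
  have "(l has_vector_derivative 0) (at t within {0..1})" if t: "t \<in> {0..1}" for t
  proof -
    \<comment> \<open>Differentiability is required before the zero value of
      \<open>vector_derivative\<close> can be read as an actual derivative.\<close>
    have "Ck_on (Suc 0) l {0..1}"
      using l by (simp only: smooth_on_def)
    then have "l differentiable (at t within {0..1})"
      using t by (auto simp: differentiable_def)
    then show ?thesis
      using dl[OF t] adjoint_ad_eq(1)[OF u[OF t] adj[OF t]]
      by (simp add: dtime_def vector_derivative_works)
  qed
  then obtain c where c: "\<And>t. t \<in> {0..1} \<Longrightarrow> l t = c"
    using has_vector_derivative_zero_constant[of "{0..1}" l] by auto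
  \<comment> \<open>As \<open>eta\<close> of the adjoint term is 0, \<open>pr0\<close> leaves that
    term unchanged. The adjoint formula carries + 2 c u', hence the witness - c.\<close>
  have "L \<alpha> \<beta> (J (deriv (\<lambda>\<theta>. dtime (\<lambda>s. u s \<theta>) t))) \<theta> =
      u t \<theta> * L \<alpha> \<beta> (J (deriv (deriv (u t)))) \<theta>
      + 2 * deriv (u t) \<theta> * L \<alpha> \<beta> (J (deriv (u t))) \<theta> - 2 * (- c) * deriv (u t) \<theta>"
    if t: "t \<in> {0..1}" for t \<theta>
    using adjoint_ad_eq[OF u[OF t] adj[OF t], of c] by (simp add: du[OF t] c[OF t] pr0_def)
  then show ?thesis
    by blast
qed

end
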